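(* Let $\Delta_n=\{x\in\mathbb{R}^n:\sum_{i=1}^nx_i=1,\ x_i\ge0\ \forall i\in[n]\}$. For any $x\in\Delta_n$ and any direction $w\in\mathbb{R}^n$, the output of the algorithm Shadow-Simplex$(x,w)$ is the shadow $d_x^\Pi(w)$. Moreover, the running time of the algorithm is $O(n\log n+n^2)$.
   Context: $d_x^\Pi(w)=\lim_{\epsilon\downarrow0}\frac{\Pi_{\Delta_n}(x-\epsilon w)-x}{\epsilon}$, where $\Pi_{\Delta_n}$ is Euclidean projection onto $\Delta_n$; equivalently $d_x^\Pi(w)=\arg\min\{\|-w-d\|^2:\sum_{i}d_i=0,\ d_i\ge0\text{ whenever }x_i=0\}$. $\odot$ is the entrywise (Hadamard) product. Running time counts arithmetic operations and comparisons on reals. Algorithm Shadow-Simplex$(x,w)$: set $g=-w$ and $I=\{i\in[n]:x_i=0\}$. Let $u\in\{0,1\}^n$ with $u_i=0$ if $i\in I$ and $u_i=1$ otherwise. Compute $d=g\odot u-\frac{\langle g,u\rangle}{\|u\|^2}u$. Order the elements of $I$ so that the values $g_i$ are non-increasing. For each $i\in I$ in this order: let $u'$ be $u$ with its $i$th entry set to $1$; compute $d'=g\odot u'-\frac{\langle g,u'\rangle}{\|u'\|^2}u'$; if $d'_j\ge0$ for all $j\in I$, set $d=d'$ and $u=u'$; else exit the loop. Return $d$. *)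

theory Defs
  imports "HOL-Analysis.Analysis" "HOL-Library.Landau_Symbols" "HOL-Library.Monad_Syntax"
begin

text \<open>
  The running time claim needs a bound that is uniform in the dimension, so \<open>\<real>\<^sup>n\<close> is the set
  of functions \<open>nat \<Rightarrow> real\<close> that vanish from index \<open>n\<close> on (coordinates are \<open>0, ..., n - 1\<close>), i.e.
  the carrier of the topology \<open>Euclidean_space n\<close>. That topology is the one inherited from
  the product topology on \<open>nat \<Rightarrow> real\<close>, in which the limits below are taken.
\<close>

abbreviation Rn :: "nat \<Rightarrow> (nat \<Rightarrow> real) set" where
  "Rn n \<equiv> topspace (Euclidean_space n)"

definition prob_simplex :: "nat \<Rightarrow> (nat \<Rightarrow> real) set" where
  "prob_simplex n = {x \<in> Rn n. (\<Sum>i<n. x i) = 1 \<and> (\<forall>i<n. 0 \<le> x i)}"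

definition simplex_proj :: "nat \<Rightarrow> (nat \<Rightarrow> real) \<Rightarrow> nat \<Rightarrow> real" where
  "simplex_proj n z = arg_min_on (\<lambda>y. L2_set (\<lambda>i. z i - y i) {..<n}) (prob_simplex n)"

definition proj_quotient :: "nat \<Rightarrow> (nat \<Rightarrow> real) \<Rightarrow> (nat \<Rightarrow> real) \<Rightarrow> real \<Rightarrow> nat \<Rightarrow> real" where
  "proj_quotient n x w \<epsilon> = (\<lambda>i. (simplex_proj n (\<lambda>j. x j - \<epsilon> * w j) i - x i) / \<epsilon>)"

definition shadow :: "nat \<Rightarrow> (nat \<Rightarrow> real) \<Rightarrow> (nat \<Rightarrow> real) \<Rightarrow> nat \<Rightarrow> real" where
  "shadow n x w = Lim (at_right 0) (proj_quotient n x w)"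


text \<open>
  Programs are written in a cost-counting monad. Each arithmetic operation and each comparison
  on reals costs 1. Sequencing adds costs. Manipulating indices, lists of indices and
  storage (including writing the constants 0 and 1 into a vector) is free.
\<close>

datatype 'a timed = Timed (result: 'a) (cost: nat)

definition ret :: "'a \<Rightarrow> 'a timed" where
  "ret a = Timed a 0"

definition bind_timed :: "'a timed \<Rightarrow> ('a \<Rightarrow> 'b timed) \<Rightarrow> 'b timed" where
  "bind_timed m f = Timed (result (f (result m))) (cost m + cost (f (result m)))"

adhoc_overloading Monad_Syntax.bind \<rightleftharpoons> bind_timed

definition radd :: "real \<Rightarrow> real \<Rightarrow> real timed" where "radd a b = Timed (a + b) 1"
definition rsub :: "real \<Rightarrow> real \<Rightarrow> real timed" where "rsub a b = Timed (a - b) 1"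
definition rneg :: "real \<Rightarrow> real timed" where "rneg a = Timed (- a) 1"
definition rmul :: "real \<Rightarrow> real \<Rightarrow> real timed" where "rmul a b = Timed (a * b) 1"
definition rdiv :: "real \<Rightarrow> real \<Rightarrow> real timed" where "rdiv a b = Timed (a / b) 1"
definition rle :: "real \<Rightarrow> real \<Rightarrow> bool timed" where "rle a b = Timed (a \<le> b) 1"
definition req :: "real \<Rightarrow> real \<Rightarrow> bool timed" where "req a b = Timed (a = b) 1"

primrec vec_of :: "nat \<Rightarrow> (nat \<Rightarrow> real timed) \<Rightarrow> (nat \<Rightarrow> real) timed" where
  "vec_of 0 f = ret (\<lambda>_. 0)"
| "vec_of (Suc n) f = do { v \<leftarrow> vec_of n f; a \<leftarrow> f n; ret (v(n := a)) }"

primrec dot :: "nat \<Rightarrow> (nat \<Rightarrow> real) \<Rightarrow> (nat \<Rightarrow> real) \<Rightarrow> real timed" where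
  "dot 0 a b = ret 0"
| "dot (Suc n) a b = do { s \<leftarrow> dot n a b; p \<leftarrow> rmul (a n) (b n); radd s p }"

text \<open>\<open>centred n g u\<close> computes \<open>g \<odot> u - (\<langle>g,u\<rangle> / \<parallel>u\<parallel>\<^sup>2) u\<close>.\<close>

definition centred :: "nat \<Rightarrow> (nat \<Rightarrow> real) \<Rightarrow> (nat \<Rightarrow> real) \<Rightarrow> (nat \<Rightarrow> real) timed" where
  "centred n g u = do {
     gu \<leftarrow> vec_of n (\<lambda>i. rmul (g i) (u i));
     a \<leftarrow> dot n g u;
     b \<leftarrow> dot n u u;
     c \<leftarrow> rdiv a b;
     cu \<leftarrow> vec_of n (\<lambda>i. rmul c (u i));
     vec_of n (\<lambda>i. rsub (gu i) (cu i)) }"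

primrec zero_indices :: "nat \<Rightarrow> (nat \<Rightarrow> real) \<Rightarrow> nat list timed" where
  "zero_indices 0 x = ret []"
| "zero_indices (Suc n) x = do {
     I \<leftarrow> zero_indices n x;
     z \<leftarrow> req (x n) 0;
     ret (if z then I @ [n] else I) }"

primrec all_nonneg :: "(nat \<Rightarrow> real) \<Rightarrow> nat list \<Rightarrow> bool timed" where
  "all_nonneg d [] = ret True"
| "all_nonneg d (j # js) = do {
     b \<leftarrow> rle 0 (d j);
     if b then all_nonneg d js else ret False }"

primrec shadow_loop ::
  "nat \<Rightarrow> (nat \<Rightarrow> real) \<Rightarrow> nat list \<Rightarrow> nat list \<Rightarrow> (nat \<Rightarrow> real) \<Rightarrow> (nat \<Rightarrow> real) \<Rightarrow> (nat \<Rightarrow> real) timed"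
where
  "shadow_loop n g I [] d u = ret d"
| "shadow_loop n g I (i # is) d u = do {
     d' \<leftarrow> centred n g (u(i := 1));
     ok \<leftarrow> all_nonneg d' I;
     if ok then shadow_loop n g I is d' (u(i := 1)) else ret d }"

text \<open>
  The ordering step is left open by the algorithm (in particular the order of ties), so the
  sorting subroutine \<open>srt\<close> is a parameter: \<open>srt g I\<close> arranges \<open>I\<close> by non-increasing value of \<open>g\<close>.
\<close>

definition shadow_simplex ::
  "((nat \<Rightarrow> real) \<Rightarrow> nat list \<Rightarrow> nat list timed) \<Rightarrow>
   nat \<Rightarrow> (nat \<Rightarrow> real) \<Rightarrow> (nat \<Rightarrow> real) \<Rightarrow> (nat \<Rightarrow> real) timed"
where
  "shadow_simplex srt n x w = do {
     g \<leftarrow> vec_of n (\<lambda>i. rneg (w i));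
     I \<leftarrow> zero_indices n x;
     let u = (\<lambda>i. if i < n \<and> i \<notin> set I then 1 else 0);
     d \<leftarrow> centred n g u;
     ord \<leftarrow> srt g I;
     shadow_loop n g I ord d u }"

definition sorting_routine :: "((nat \<Rightarrow> real) \<Rightarrow> nat list \<Rightarrow> nat list timed) \<Rightarrow> bool" where
  "sorting_routine srt \<longleftrightarrow>
     (\<forall>g I. mset (result (srt g I)) = mset I \<and>
            sorted_wrt (\<lambda>i j. g i \<ge> g j) (result (srt g I)))"

fun merge :: "(nat \<Rightarrow> real) \<Rightarrow> nat list \<Rightarrow> nat list \<Rightarrow> nat list timed" where
  "merge g [] js = ret js"
| "merge g is [] = ret is"
| "merge g (i # is) (j # js) = do {
     b \<leftarrow> rle (g j) (g i);
     if b then do { ks \<leftarrow> merge g is (j # js); ret (i # ks) }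
     else do { ks \<leftarrow> merge g (i # is) js; ret (j # ks) } }"

fun merge_sort :: "(nat \<Rightarrow> real) \<Rightarrow> nat list \<Rightarrow> nat list timed" where
  "merge_sort g is =
     (if length is \<le> 1 then ret is
      else do {
        ls \<leftarrow> merge_sort g (take (length is div 2) is);
        rs \<leftarrow> merge_sort g (drop (length is div 2) is);
        merge g ls rs })"

declare merge_sort.simps [simp del]

lemma result_simps [simp]:
  "result (ret a) = a"
  "result (bind_timed m f) = result (f (result m))"
  "result (rle r s) = (r \<le> s)"
  by (simp_all add: ret_def bind_timed_def rle_def)

lemma mset_merge [simp]: "mset (result (merge g is js)) = mset is + mset js"
  by (induction g "is" js rule: merge.induct) auto

lemma sorted_merge:
  assumes "sorted_wrt (\<lambda>i j. g i \<ge> g j) is" "sorted_wrt (\<lambda>i j. g i \<ge> g j) js"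
  shows "sorted_wrt (\<lambda>i j. g i \<ge> g j) (result (merge g is js))"
  using assms
proof (induction g "is" js rule: merge.induct)
  case (3 g i "is" j js)
  have "set (result (merge g is js)) = set is \<union> set js" for "is" js
    by (metis mset_merge set_mset_mset set_mset_union)
  with 3 show ?case by fastforce
qed auto

lemma sorting_routine_merge_sort: "sorting_routine merge_sort"
proof -
  have "mset (result (merge_sort g is)) = mset is \<and>
        sorted_wrt (\<lambda>i j. g i \<ge> g j) (result (merge_sort g is))" for g "is"
  proof (induction g "is" rule: merge_sort.induct)
    case (1 g "is")
    show ?case
    proof (cases "length is \<le> 1")
      case True
      then show ?thesis by (cases "is") (auto simp: merge_sort.simps)
    next
      case False
      have "mset (take k is) + mset (drop k is) = mset is" for k
        by (metis append_take_drop_id mset_append)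
      with False 1 show ?thesis
        by (subst (1 2) merge_sort.simps) (simp add: sorted_merge)
    qed
  qed
  then show ?thesis by (simp add: sorting_routine_def)
qed

end

theory Submission imports Defs begin

text \<open>
  Write \<open>g = - w\<close> and let \<open>I\<close> be the set of zero coordinates of \<open>x\<close>. The proof rests on one
  optimality certificate: a point \<open>y\<close> of the simplex is the projection of \<open>z\<close> as soon as it is a
  thresholding of \<open>z\<close>, i.e. \<open>y\<^sub>i = max 0 (z\<^sub>i - \<tau>)\<close> for a common \<open>\<tau>\<close>
  (\<open>simplex_proj_eqI\<close>; \<open>\<tau>\<close> is the Lagrange multiplier of the sum constraint).

  Suppose \<open>d\<close> sums to zero and satisfies, for a common \<open>\<mu>\<close>, that \<open>d\<^sub>i = g\<^sub>i - \<mu>\<close> on the support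
  of \<open>x\<close> and \<open>d\<^sub>i = max 0 (g\<^sub>i - \<mu>)\<close> on \<open>I\<close>. These are the optimality conditions for \<open>d\<close> as the
  point closest to \<open>g\<close> in the tangent cone. For small \<open>\<epsilon> > 0\<close> the support coordinates of
  \<open>x + \<epsilon> d\<close> remain positive, so \<open>x + \<epsilon> d\<close> is the thresholding of \<open>x + \<epsilon> g\<close> at \<open>\<epsilon> \<mu>\<close> and hence
  its projection. The difference quotient is therefore not merely convergent to \<open>d\<close> but equal
  to it for all small \<open>\<epsilon>\<close> (\<open>proj_quotient_eventually_eq\<close>), which settles existence and value
  of the limit together.

  The loop finds such a \<open>d\<close>, with \<open>\<mu>\<close> the mean of \<open>g\<close> over the current set \<open>U\<close>
  (\<open>shadow_loop_result\<close>). A new element \<open>i\<close> lies above the updated mean exactly if it lies above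
  the old one. Since elements arrive in non-increasing order of \<open>g\<close>, as long as the test succeeds
  all admitted elements of \<open>I\<close> lie above the current mean, and at the first failure all remaining
  ones lie below it. That is the thresholding condition on \<open>I\<close>.

  The cost is dominated by at most \<open>n\<close> rounds of a linear amount of work. The bound
  \<open>O(n log n + n\<^sup>2)\<close> equals \<open>O(n\<^sup>2)\<close>, so for the sorting phase a quadratic bound is enough.
\<close>

section \<open>Projection onto the simplex and its directional derivative\<close>

lemma mem_Rn_iff: "x \<in> Rn n \<longleftrightarrow> (\<forall>i\<ge>n. x i = 0)"
  by (auto simp: topspace_Euclidean_space)

text \<open>
  The certificate gives the variational inequality \<open>\<langle>z - y, v - y\<rangle> \<le> 0\<close> for every \<open>v\<close> in the
  simplex. Expanding \<open>\<parallel>z - v\<parallel>\<^sup>2\<close> around \<open>y\<close> then shows that \<open>y\<close> beats \<open>v\<close> by at least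
  \<open>\<parallel>y - v\<parallel>\<^sup>2\<close>, so \<open>y\<close> is the only minimiser and the choice made by \<open>arg_min_on\<close> is forced.
\<close>

lemma simplex_proj_eqI:
  assumes y: "y \<in> prob_simplex n"
    and thr: "\<And>i. i < n \<Longrightarrow> y i = max 0 (z i - \<tau>)"
  shows "simplex_proj n z = y"
proof -
  define f where "f = (\<lambda>v. L2_set (\<lambda>i. z i - v i) {..<n})"
  have f_mono: "(f v < f v') = ((\<Sum>i<n. (z i - v i)\<^sup>2) < (\<Sum>i<n. (z i - v' i)\<^sup>2))" for v v'
    by (simp add: f_def L2_set_def)
  have gap: "(\<Sum>i<n. (z i - y i)\<^sup>2) + (\<Sum>i<n. (y i - v i)\<^sup>2) \<le> (\<Sum>i<n. (z i - v i)\<^sup>2)"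
    if v: "v \<in> prob_simplex n" for v
  proof -
    \<comment> \<open>Both points have coordinate sum 1, so shifting \<open>z - y\<close> by \<open>\<tau>\<close> does not change its
      inner product with \<open>v - y\<close>; after the shift every summand has the right sign.\<close>
    have "(z i - y i - \<tau>) * (v i - y i) \<le> 0" if "i < n" for i
    proof (cases "0 \<le> z i - \<tau>")
      case True
      then show ?thesis using thr[OF that] by simp
    next
      case False
      moreover have "0 \<le> v i" using v that by (simp add: prob_simplex_def)
      ultimately show ?thesis using thr[OF that] by (simp add: mult_nonpos_nonneg)
    qed
    then have "(\<Sum>i<n. (z i - y i - \<tau>) * (v i - y i)) \<le> 0"
      by (intro sum_nonpos) auto
    moreover have "(\<Sum>i<n. \<tau> * (v i - y i)) = 0"
      using y v by (simp add: prob_simplex_def sum_subtractf flip: sum_distrib_left)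
    moreover have "(\<Sum>i<n. (z i - v i)\<^sup>2) = (\<Sum>i<n. (z i - y i)\<^sup>2) + (\<Sum>i<n. (y i - v i)\<^sup>2)
        - 2 * (\<Sum>i<n. (z i - y i - \<tau>) * (v i - y i)) - 2 * (\<Sum>i<n. \<tau> * (v i - y i))"
      unfolding sum_distrib_left sum_subtractf[symmetric] sum.distrib[symmetric]
      by (rule sum.cong) (auto simp: algebra_simps power2_eq_square)
    ultimately show ?thesis by linarith
  qed
  have "is_arg_min f (\<lambda>v. v \<in> prob_simplex n) v \<longleftrightarrow> v = y" for v
  proof
    assume v: "is_arg_min f (\<lambda>v. v \<in> prob_simplex n) v"
    then have v': "v \<in> prob_simplex n" and "\<not> f y < f v"
      using y by (auto simp: is_arg_min_def)
    with gap[OF v'] have "(\<Sum>i<n. (y i - v i)\<^sup>2) \<le> 0" by (simp add: f_mono)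
    then have "(\<Sum>i<n. (y i - v i)\<^sup>2) = 0" by (simp add: order_antisym sum_nonneg)
    then have "\<forall>i<n. v i = y i" by (simp add: sum_nonneg_eq_0_iff)
    moreover have "\<forall>i\<ge>n. v i = y i" using v' y by (simp add: prob_simplex_def mem_Rn_iff)
    ultimately show "v = y" by (metis ext not_le)
  next
    assume "v = y"
    moreover have "\<not> f v < f y" if "v \<in> prob_simplex n" for v
      using gap[OF that] sum_nonneg[of "{..<n}" "\<lambda>i. (y i - v i)\<^sup>2"] by (simp add: f_mono)
    ultimately show "is_arg_min f (\<lambda>v. v \<in> prob_simplex n) v"
      using y by (auto simp: is_arg_min_def)
  qed
  then show ?thesis
    by (simp add: simplex_proj_def arg_min_on_def arg_min_def flip: f_def)
qed

text \<open>
  The simplex is a polyhedron, so near \<open>x\<close> it agrees with \<open>x\<close> plus its tangent cone, and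
  projecting \<open>x - \<epsilon> w\<close> commutes with scaling by \<open>\<epsilon>\<close>. How small \<open>\<epsilon>\<close> must be is dictated only by
  the finitely many positive coordinates of \<open>x\<close>, which must not be pushed below zero.
\<close>

lemma proj_quotient_eventually_eq:
  assumes x: "x \<in> prob_simplex n"
    and d_Rn: "d \<in> Rn n"
    and d_sum: "(\<Sum>i<n. d i) = 0"
    and pos: "\<And>i. \<lbrakk>i < n; x i \<noteq> 0\<rbrakk> \<Longrightarrow> d i = - w i - \<mu>"
    and zero: "\<And>i. \<lbrakk>i < n; x i = 0\<rbrakk> \<Longrightarrow> d i = max 0 (- w i - \<mu>)"
  shows "eventually (\<lambda>\<epsilon>. proj_quotient n x w \<epsilon> = d) (at_right 0)"
proof -
  have x0: "0 \<le> x i" if "i < n" for i using x that by (simp add: prob_simplex_def)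
  have "eventually (\<lambda>\<epsilon>. 0 < x i + \<epsilon> * d i) (at_right 0)" if "i < n" "x i \<noteq> 0" for i
  proof -
    have "((\<lambda>\<epsilon>. x i + \<epsilon> * d i) \<longlongrightarrow> x i + 0 * d i) (at_right 0)"
      by (intro tendsto_intros)
    moreover have "0 < x i + 0 * d i" using x0[OF that(1)] that(2) by simp
    ultimately show ?thesis by (rule order_tendstoD(1))
  qed
  then have "eventually (\<lambda>\<epsilon>. \<forall>i\<in>{i. i < n \<and> x i \<noteq> 0}. 0 < x i + \<epsilon> * d i) (at_right 0)"
    by (intro eventually_ball_finite) auto
  moreover have "eventually (\<lambda>\<epsilon>::real. 0 < \<epsilon>) (at_right 0)"
    by (simp add: eventually_at_right_less)
  ultimately show ?thesis
  proof eventually_elim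
    case (elim \<epsilon>)
    \<comment> \<open>The projection threshold scales with the step: it is \<open>\<epsilon> * \<mu>\<close>.\<close>
    have thr: "x i + \<epsilon> * d i = max 0 (x i - \<epsilon> * w i - \<epsilon> * \<mu>)" if "i < n" for i
    proof (cases "x i = 0")
      case True
      have "\<epsilon> * max 0 (- w i - \<mu>) = max (\<epsilon> * 0) (\<epsilon> * (- w i - \<mu>))"
        using elim(2) by (intro max_mult_distrib_left[THEN trans]) auto
      then show ?thesis using zero[OF that True] True by (simp add: algebra_simps)
    next
      case False
      then have "0 < x i + \<epsilon> * d i" using elim(1) that by blast
      moreover have "\<epsilon> * d i = \<epsilon> * (- w i - \<mu>)" using pos[OF that False] by simp
      ultimately show ?thesis by (simp add: algebra_simps)
    qed
    have "(\<lambda>i. x i + \<epsilon> * d i) \<in> prob_simplex n"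
    proof -
      have "(\<lambda>i. x i + \<epsilon> * d i) \<in> Rn n"
        using x d_Rn by (simp add: prob_simplex_def mem_Rn_iff)
      moreover have "(\<Sum>i<n. x i + \<epsilon> * d i) = 1"
        using x d_sum by (simp add: prob_simplex_def sum.distrib flip: sum_distrib_left)
      moreover have "\<forall>i<n. 0 \<le> x i + \<epsilon> * d i" using thr by simp
      ultimately show ?thesis by (simp add: prob_simplex_def)
    qed
    then have "simplex_proj n (\<lambda>j. x j - \<epsilon> * w j) = (\<lambda>i. x i + \<epsilon> * d i)"
      by (rule simplex_proj_eqI) (rule thr)
    then show ?case using elim(2) by (simp add: proj_quotient_def)
  qed
qed

section \<open>What the loop computes\<close>

definition mean :: "(nat \<Rightarrow> real) \<Rightarrow> nat set \<Rightarrow> real" where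
  "mean g U = sum g U / card U"

definition centred_on :: "(nat \<Rightarrow> real) \<Rightarrow> nat set \<Rightarrow> nat \<Rightarrow> real" where
  "centred_on g U = (\<lambda>i. if i \<in> U then g i - mean g U else 0)"

lemma result_arith [simp]:
  "result (radd a b) = a + b" "result (rsub a b) = a - b" "result (rneg a) = - a"
  "result (rmul a b) = a * b" "result (rdiv a b) = a / b" "result (req a b) = (a = b)"
  by (simp_all add: radd_def rsub_def rneg_def rmul_def rdiv_def req_def)

lemma result_vec_of [simp]:
  "result (vec_of n f) = (\<lambda>i. if i < n then result (f i) else 0)"
  by (induction n) (auto simp: fun_eq_iff less_Suc_eq)

lemma result_dot [simp]: "result (dot n a b) = (\<Sum>i<n. a i * b i)"
  by (induction n) auto

lemma result_zero_indices [simp]: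
  "result (zero_indices n x) = filter (\<lambda>i. x i = 0) [0..<n]"
  by (induction n) auto

lemma result_all_nonneg [simp]: "result (all_nonneg d js) = (\<forall>j\<in>set js. 0 \<le> d j)"
  by (induction js) auto

lemma result_centred_indicator:
  assumes "U \<subseteq> {..<n}"
  shows "result (centred n g (indicat_real U)) = centred_on g U"
proof -
  have *: "(\<Sum>i<n. f i * indicat_real U i) = sum f U" for f
    using assms by (simp add: sum.inter_restrict[symmetric] indicator_def Int_absorb1 if_distrib cong: if_cong)
  have "(\<Sum>i<n. indicat_real U i * indicat_real U i) = card U"
    using assms unfolding * by simp
  then show ?thesis
    using assms by (auto simp: centred_def * centred_on_def mean_def fun_eq_iff)
qed

lemma sum_centred_on: "finite U \<Longrightarrow> U \<noteq> {} \<Longrightarrow> sum (centred_on g U) U = 0"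
  by (simp add: centred_on_def mean_def sum_subtractf)

text \<open>
  The new mean is a proper convex combination of the old mean and \<open>g i\<close>, so \<open>g i\<close> lies on the
  same side of both.
\<close>

lemma mean_insert_le_iff:
  assumes "finite U" "U \<noteq> {}" "i \<notin> U"
  shows "mean g (insert i U) \<le> g i \<longleftrightarrow> mean g U \<le> g i"
proof -
  have "card U > 0" using assms by (simp add: card_gt_0_iff)
  then show ?thesis using assms by (simp add: mean_def field_simps)
qed

text \<open>
  The loop invariant: the vector \<open>u\<close> is the indicator of a set \<open>U\<close> made of the support and an
  initial segment of the ordering; \<open>g\<close> on the admitted part of \<open>I\<close> is at least the mean over \<open>U\<close>
  and dominates \<open>g\<close> on everything still to come. The last two conjuncts of the conclusion say that
  \<open>centred_on g V\<close> is on \<open>I\<close> the positive part of \<open>g - mean g V\<close>.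
\<close>

lemma shadow_loop_result:
  assumes "sorted_wrt (\<lambda>i j. g i \<ge> g j) is" "distinct is"
    and "U \<subseteq> {..<n}" "U \<noteq> {}" "set is \<subseteq> {..<n}" "U \<inter> set is = {}"
    and "set I \<subseteq> U \<union> set is" "set is \<subseteq> set I"
    and "\<And>j. j \<in> U \<inter> set I \<Longrightarrow> mean g U \<le> g j"
    and "\<And>i j. j \<in> U \<inter> set I \<Longrightarrow> i \<in> set is \<Longrightarrow> g i \<le> g j"
  shows "\<exists>V. U \<subseteq> V \<and> V \<subseteq> {..<n} \<and>
           result (shadow_loop n g I is (centred_on g U) (indicat_real U)) = centred_on g V \<and>
           (\<forall>j\<in>set I \<inter> V. mean g V \<le> g j) \<and> (\<forall>j\<in>set I - V. g j \<le> mean g V)"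
  using assms
proof (induction "is" arbitrary: U)
  case Nil
  then show ?case by (intro exI[of _ U]) auto
next
  case (Cons i "is")
  let ?U = "insert i U"
  have fin: "finite U" using Cons.prems(3) finite_subset by blast
  have i: "i \<notin> U" "i < n" "i \<in> set I" using Cons.prems by auto
  have upd: "(indicat_real U)(i := 1) = indicat_real ?U"
    by (auto simp: fun_eq_iff indicator_def)
  have res: "result (centred n g (indicat_real ?U)) = centred_on g ?U"
    using Cons.prems(3) i(2) by (intro result_centred_indicator) auto
  have step: "mean g ?U \<le> g i \<longleftrightarrow> mean g U \<le> g i"
    by (rule mean_insert_le_iff) (use fin i Cons.prems(4) in auto)
  have newest: "g i \<le> g j" if "j \<in> ?U \<inter> set I" for j
    using Cons.prems(10)[of j i] that by auto
  \<comment> \<open>The entry just added is the smallest among the admitted zero coordinates, so the test over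
    all of \<open>I\<close> is decided by it alone.\<close>
  have test: "(\<forall>j\<in>set I. 0 \<le> centred_on g ?U j) \<longleftrightarrow> mean g U \<le> g i"
  proof
    assume "\<forall>j\<in>set I. 0 \<le> centred_on g ?U j"
    then have "0 \<le> centred_on g ?U i" using i(3) by blast
    then show "mean g U \<le> g i" by (simp add: centred_on_def step)
  next
    assume "mean g U \<le> g i"
    then have "mean g ?U \<le> g j" if "j \<in> ?U \<inter> set I" for j
      using newest[OF that] step by linarith
    then show "\<forall>j\<in>set I. 0 \<le> centred_on g ?U j" by (auto simp: centred_on_def)
  qed
  show ?case
  proof (cases "mean g U \<le> g i")
    case True
    have "\<exists>V. ?U \<subseteq> V \<and> V \<subseteq> {..<n} \<and>
           result (shadow_loop n g I is (centred_on g ?U) (indicat_real ?U)) = centred_on g V \<and>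
           (\<forall>j\<in>set I \<inter> V. mean g V \<le> g j) \<and> (\<forall>j\<in>set I - V. g j \<le> mean g V)"
    proof (rule Cons.IH)
      show "mean g ?U \<le> g j" if "j \<in> ?U \<inter> set I" for j
        using newest[OF that] step True by linarith
      show "g k \<le> g j" if "j \<in> ?U \<inter> set I" "k \<in> set is" for j k
        using newest[OF that(1)] that(2) Cons.prems(1) by fastforce
    qed (use Cons.prems in auto)
    then show ?thesis using True by (auto simp: upd res test)
  next
    case False
    \<comment> \<open>An element of \<open>I\<close> outside \<open>U\<close> is \<open>i\<close> or comes later, so it is no larger than \<open>g i\<close>.\<close>
    have "g j \<le> mean g U" if "j \<in> set I - U" for j
      using False Cons.prems(1,7) that by fastforce
    then show ?thesis
      using False Cons.prems by (intro exI[of _ U]) (auto simp: upd res test)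
  qed
qed

text \<open>
  The final mean is the multiplier \<open>\<mu>\<close>. On the support of \<open>x\<close> nothing is thresholded because
  \<open>U\<close> starts as the support and only grows.
\<close>

theorem shadow_simplex_correct:
  assumes srt: "sorting_routine srt" and x: "x \<in> prob_simplex n"
  shows "eventually (\<lambda>\<epsilon>. proj_quotient n x w \<epsilon> = result (shadow_simplex srt n x w)) (at_right 0)"
proof -
  define g where "g = (\<lambda>i. if i < n then - w i else 0)"
  define I where "I = filter (\<lambda>i. x i = 0) [0..<n]"
  define js where "js = result (srt g I)"
  define U where "U = {..<n} - set I"
  have "mset js = mset I" and sorted: "sorted_wrt (\<lambda>i j. g i \<ge> g j) js"
    using srt by (auto simp: sorting_routine_def js_def)
  then have set_js: "set js = set I" and dist: "distinct js"
    by (metis set_mset_mset, metis I_def distinct_filter distinct_upt mset_eq_imp_distinct_iff)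
  have set_I: "set I = {i. i < n \<and> x i = 0}" by (auto simp: I_def)
  \<comment> \<open>The coordinates of \<open>x\<close> sum to 1, so they cannot all vanish.\<close>
  have "U \<noteq> {}"
  proof
    assume "U = {}"
    then have "(\<Sum>i<n. x i) = 0" by (intro sum.neutral) (auto simp: U_def set_I)
    then show False using x by (simp add: prob_simplex_def)
  qed
  have u: "(\<lambda>i. if i < n \<and> i \<notin> set I then 1 else 0) = indicat_real U"
    by (auto simp: U_def indicator_def)
  have g: "result (vec_of n (\<lambda>i. rneg (w i))) = g" by (auto simp: g_def)
  have run: "result (shadow_simplex srt n x w) =
      result (shadow_loop n g I js (centred_on g U) (indicat_real U))"
    unfolding shadow_simplex_def
    by (simp add: Let_def g u result_centred_indicator U_def js_def del: result_vec_of flip: I_def)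
  obtain V where V: "U \<subseteq> V" "V \<subseteq> {..<n}"
      "result (shadow_simplex srt n x w) = centred_on g V"
      "\<forall>j\<in>set I \<inter> V. mean g V \<le> g j" "\<forall>j\<in>set I - V. g j \<le> mean g V"
  proof -
    have "U \<subseteq> {..<n}" "set js \<subseteq> {..<n}" "U \<inter> set js = {}" "U \<inter> set I = {}"
      by (auto simp: U_def set_js set_I)
    then show thesis
      using shadow_loop_result[OF sorted dist, of U n I] \<open>U \<noteq> {}\<close> that
      by (auto simp: run set_js)
  qed
  have "eventually (\<lambda>\<epsilon>. proj_quotient n x w \<epsilon> = centred_on g V) (at_right 0)"
  proof (rule proj_quotient_eventually_eq[OF x, where \<mu> = "mean g V"])
    show "centred_on g V \<in> Rn n" using V(2) by (auto simp: mem_Rn_iff centred_on_def)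
    have "(\<Sum>i<n. centred_on g V i) = sum (centred_on g V) V"
      using V(2) by (intro sum.mono_neutral_right) (auto simp: centred_on_def)
    also have "\<dots> = 0"
      using V(1,2) \<open>U \<noteq> {}\<close> finite_subset by (intro sum_centred_on) auto
    finally show "(\<Sum>i<n. centred_on g V i) = 0" .
    show "centred_on g V i = - w i - mean g V" if "i < n" "x i \<noteq> 0" for i
      using that V(1) by (auto simp: centred_on_def U_def set_I g_def)
    show "centred_on g V i = max 0 (- w i - mean g V)" if "i < n" "x i = 0" for i
      using that V(4,5) by (auto simp: centred_on_def set_I g_def)
  qed
  then show ?thesis by (simp add: V(3))
qed

section \<open>Running time\<close>

lemma cost_simps [simp]:
  "cost (ret a) = 0"
  "cost (bind_timed m f) = cost m + cost (f (result m))"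
  "cost (radd r s) = 1" "cost (rsub r s) = 1" "cost (rneg r) = 1" "cost (rmul r s) = 1"
  "cost (rdiv r s) = 1" "cost (rle r s) = 1" "cost (req r s) = 1"
  by (simp_all add: ret_def bind_timed_def radd_def rsub_def rneg_def rmul_def rdiv_def
      rle_def req_def)

lemma cost_vec_of [simp]: "cost (vec_of n f) = (\<Sum>i<n. cost (f i))"
  by (induction n) auto

lemma cost_dot [simp]: "cost (dot n a b) = 2 * n"
  by (induction n) auto

lemma cost_centred: "cost (centred n g u) = 7 * n + 1"
  by (simp add: centred_def)

lemma cost_zero_indices [simp]: "cost (zero_indices n x) = n"
  by (induction n) auto

lemma cost_all_nonneg: "cost (all_nonneg d js) \<le> length js"
  by (induction js) auto

lemma cost_shadow_loop:
  "cost (shadow_loop n g I is d u) \<le> length is * (7 * n + 1 + length I)"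
proof (induction "is" arbitrary: d u)
  case (Cons i "is")
  let ?d = "result (centred n g (u(i := 1)))"
  have "cost (shadow_loop n g I (i # is) d u) \<le>
      (7 * n + 1) + (cost (all_nonneg ?d I) + cost (shadow_loop n g I is ?d (u(i := 1))))"
    by (simp add: cost_centred)
  also have "\<dots> \<le> (7 * n + 1) + (length I + length is * (7 * n + 1 + length I))"
    by (intro add_left_mono add_mono cost_all_nonneg Cons.IH)
  finally show ?case by simp
qed simp

lemma cost_merge: "cost (merge g is js) \<le> length is + length js"
  by (induction g "is" js rule: merge.induct) auto

lemma length_merge_sort: "length (result (merge_sort g is)) = length is"
  using sorting_routine_merge_sort by (metis sorting_routine_def size_mset)

text \<open>
  The induction closes because \<open>a\<^sup>2 + b\<^sup>2 + (a + b) \<le> (a + b)\<^sup>2\<close> for nonempty halves of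
  lengths \<open>a\<close> and \<open>b\<close>; the sharper \<open>n log n\<close> would be swallowed by the quadratic loop.
\<close>

lemma cost_merge_sort: "cost (merge_sort g is) \<le> (length is)\<^sup>2"
proof (induction g "is" rule: merge_sort.induct)
  case (1 g "is")
  show ?case
  proof (cases "length is \<le> 1")
    case True
    then show ?thesis by (simp add: merge_sort.simps)
  next
    case False
    define a where "a = length is div 2"
    define b where "b = length is - a"
    have ab: "length is = a + b" "a \<ge> 1" "b \<ge> 1" using False by (auto simp: a_def b_def)
    have "cost (merge_sort g is) \<le> a\<^sup>2 + b\<^sup>2 + (a + b)"
    proof -
      let ?ls = "take a is" and ?rs = "drop a is"
      have "cost (merge_sort g is) = cost (merge_sort g ?ls) + (cost (merge_sort g ?rs) +
          cost (merge g (result (merge_sort g ?ls)) (result (merge_sort g ?rs))))"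
        using False by (subst merge_sort.simps) (simp add: a_def)
      moreover have "cost (merge_sort g ?ls) \<le> a\<^sup>2" "cost (merge_sort g ?rs) \<le> b\<^sup>2"
        using 1[OF False, folded a_def] ab(1) by simp_all
      moreover have "cost (merge g (result (merge_sort g ?ls)) (result (merge_sort g ?rs))) \<le> a + b"
        using cost_merge[of g "result (merge_sort g ?ls)" "result (merge_sort g ?rs)"] ab
        by (simp add: length_merge_sort)
      ultimately show ?thesis by linarith
    qed
    also have "\<dots> \<le> (a + b)\<^sup>2"
    proof -
      have "a \<le> a * b" "b \<le> a * b" using ab by simp_all
      then have "a + b \<le> 2 * (a * b)" by linarith
      then show ?thesis by (simp add: power2_sum)
    qed
    finally show ?thesis by (simp add: ab)
  qed
qed

text \<open>
  Besides sorting and the loop there are \<open>n\<close> negations, \<open>n\<close> zero tests and one centring. Each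
  of the at most \<open>n\<close> rounds consists of one centring and at most \<open>n\<close> sign tests.
\<close>

lemma cost_shadow_simplex: "cost (shadow_simplex merge_sort n x w) \<le> 9 * n\<^sup>2 + 10 * n + 1"
proof -
  define g where "g = (\<lambda>i. if i < n then - w i else 0)"
  define I where "I = filter (\<lambda>i. x i = 0) [0..<n]"
  define js where "js = result (merge_sort g I)"
  define u :: "nat \<Rightarrow> real" where "u = (\<lambda>i. if i < n \<and> i \<notin> set I then 1 else 0)"
  define d where "d = result (centred n g u)"
  have g: "result (vec_of n (\<lambda>i. rneg (w i))) = g" by (auto simp: g_def)
  have len: "length I \<le> n" "length js \<le> n"
    unfolding js_def length_merge_sort I_def using length_filter_le[of _ "[0..<n]"] by auto
  have "cost (merge_sort g I) \<le> n\<^sup>2"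
    using cost_merge_sort[of g I] len(1) by (meson le_trans power_mono zero_le)
  moreover have "cost (shadow_loop n g I js d u) \<le> n * (8 * n + 1)"
  proof -
    have "length js * (7 * n + 1 + length I) \<le> n * (8 * n + 1)"
      using len by (intro mult_le_mono) auto
    then show ?thesis using cost_shadow_loop le_trans by blast
  qed
  moreover have "cost (shadow_simplex merge_sort n x w) =
      n + (n + (7 * n + 1 + (cost (merge_sort g I) + cost (shadow_loop n g I js d u))))"
    unfolding shadow_simplex_def
    by (simp add: Let_def g cost_centred d_def u_def js_def del: result_vec_of flip: I_def)
  ultimately show ?thesis by (simp add: algebra_simps power2_eq_square)
qed

section \<open>Correctness and running time of Shadow-Simplex\<close>

theorem lemma4:
  shows "(\<forall>srt n. \<forall>x \<in> prob_simplex n. \<forall>w \<in> Rn n. sorting_routine srt \<longrightarrow>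
            (proj_quotient n x w \<longlongrightarrow> shadow n x w) (at_right 0) \<and>
            result (shadow_simplex srt n x w) = shadow n x w)
       \<and> (\<exists>T :: nat \<Rightarrow> nat.
            (\<forall>n. \<forall>x \<in> prob_simplex n. \<forall>w \<in> Rn n. cost (shadow_simplex merge_sort n x w) \<le> T n) \<and>
            (\<lambda>n. real (T n)) \<in> O(\<lambda>n. real n * ln (real n) + (real n)\<^sup>2))"
proof (intro conjI allI ballI impI exI)
  fix srt n x w
  assume "x \<in> prob_simplex n" "w \<in> Rn n" "sorting_routine srt"
  then have lim: "(proj_quotient n x w \<longlongrightarrow> result (shadow_simplex srt n x w)) (at_right 0)"
    by (intro tendsto_eventually shadow_simplex_correct)
  then have "shadow n x w = result (shadow_simplex srt n x w)"
    unfolding shadow_def by (intro tendsto_Lim) auto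
  with lim show "(proj_quotient n x w \<longlongrightarrow> shadow n x w) (at_right 0)"
    and "result (shadow_simplex srt n x w) = shadow n x w" by simp_all
next
  show "cost (shadow_simplex merge_sort n x w) \<le> 9 * n\<^sup>2 + 10 * n + 1" for n x w
    by (rule cost_shadow_simplex)
  show "(\<lambda>n. real (9 * n\<^sup>2 + 10 * n + 1)) \<in> O(\<lambda>n. real n * ln (real n) + (real n)\<^sup>2)"
  proof (rule bigoI)
    show "eventually (\<lambda>n. norm (real (9 * n\<^sup>2 + 10 * n + 1)) \<le>
        20 * norm (real n * ln (real n) + (real n)\<^sup>2)) at_top"
      using eventually_ge_at_top[of 1]
    proof eventually_elim
      case (elim n)
      then have "n \<le> n * n" "1 \<le> n * n" by simp_all
      then have "9 * n\<^sup>2 + 10 * n + 1 \<le> 20 * n\<^sup>2"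
        unfolding power2_eq_square by linarith
      then have "real (9 * n\<^sup>2 + 10 * n + 1) \<le> 20 * (real n)\<^sup>2"
        by (metis of_nat_le_iff of_nat_mult of_nat_numeral of_nat_power)
      moreover have "0 \<le> real n * ln (real n)" using elim by simp
      ultimately show ?case by simp
    qed
  qed
qed

end
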